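(* Let $F:\mathbb{C}[x,y]\to\mathbb{C}[x,y]$ be a $\mathbb{C}$-algebra endomorphism having an invertible Jacobian. Let $u,v\in\mathbb{C}[F(x),F(y),x]\setminus\{0\}$ be such that $y=u/v$ (in $\mathbb{C}(x,y)$). Assume that $v$ is a product of prime elements of the ring $\mathbb{C}[F(x),F(y),x]$. Then $F$ is an automorphism of the $\mathbb{C}$-algebra $\mathbb{C}[x,y]$.
   Context: $\mathbb{C}[x,y]$ is the polynomial ring in two variables over the complex numbers, and $\mathbb{C}(x,y)$ is its field of fractions. A $\mathbb{C}$-algebra endomorphism $F$ of $\mathbb{C}[x,y]$ has an invertible Jacobian if the Jacobian determinant $\operatorname{Jac}(F(x),F(y))=\frac{\partial F(x)}{\partial x}\frac{\partial F(y)}{\partial y}-\frac{\partial F(x)}{\partial y}\frac{\partial F(y)}{\partial x}$ lies in $\mathbb{C}^*=\mathbb{C}\setminus\{0\}$. $\mathbb{C}[F(x),F(y),x]$ denotes the $\mathbb{C}$-subalgebra of $\mathbb{C}[x,y]$ generated by $F(x)$, $F(y)$ and $x$. By a known theorem of Formanek, if $F$ has an invertible Jacobian then $\mathbb{C}(F(x),F(y),x)=\mathbb{C}(x,y)$, so nonzero $u,v\in\mathbb{C}[F(x),F(y),x]$ with $y=u/v$ always exist. *)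

theory Defs
  imports
    "HOL-Computational_Algebra.Computational_Algebra"
    "HOL-Algebra.Algebraic_Closure_Type"
    "HOL-Algebra.Ring_Divisibility"
    "HOL-Algebra.Generated_Rings"
begin

text \<open>
  The ring C[x,y] is rendered as C[x][y], i.e. as the type \<^typ>\<open>complex poly poly\<close>:
  the inner polynomials are polynomials in x, the outer variable is y.
  Its field of fractions C(x,y) is then \<^typ>\<open>complex poly poly fract\<close>.
\<close>

type_synonym cpoly2 = "complex poly poly"

definition const2 :: "complex \<Rightarrow> cpoly2" where
  "const2 c = [:[:c:]:]"

definition var_x :: cpoly2 where
  "var_x = [:[:0, 1:]:]"

definition var_y :: cpoly2 where
  "var_y = [:0, 1:]"

definition Cxy :: "cpoly2 ring" where
  "Cxy = ring_of_type_algebra"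

definition C_algebra_endomorphism :: "(cpoly2 \<Rightarrow> cpoly2) \<Rightarrow> bool" where
  "C_algebra_endomorphism F \<longleftrightarrow>
     F \<in> ring_hom Cxy Cxy \<and> (\<forall>c. F (const2 c) = const2 c)"

definition C_algebra_automorphism :: "(cpoly2 \<Rightarrow> cpoly2) \<Rightarrow> bool" where
  "C_algebra_automorphism F \<longleftrightarrow>
     F \<in> ring_iso Cxy Cxy \<and> (\<forall>c. F (const2 c) = const2 c)"

text \<open>
  Differentiation with respect to x acts on the coefficients, which are polynomials in x;
  differentiation with respect to y is the formal derivative of the outer polynomial.
\<close>

definition partial_x :: "cpoly2 \<Rightarrow> cpoly2" where
  "partial_x p = map_poly pderiv p"

definition partial_y :: "cpoly2 \<Rightarrow> cpoly2" where
  "partial_y p = pderiv p"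

definition Jac :: "cpoly2 \<Rightarrow> cpoly2 \<Rightarrow> cpoly2" where
  "Jac p q = partial_x p * partial_y q - partial_y p * partial_x q"

definition invertible_Jacobian :: "(cpoly2 \<Rightarrow> cpoly2) \<Rightarrow> bool" where
  "invertible_Jacobian F \<longleftrightarrow> (\<exists>c. c \<noteq> 0 \<and> Jac (F var_x) (F var_y) = const2 c)"

text \<open>
  The C-subalgebra of C[x,y] generated by S: the subring generated by S and the constants.
\<close>

definition C_subalgebra :: "cpoly2 set \<Rightarrow> cpoly2 set" where
  "C_subalgebra S = generate_ring Cxy (range const2 \<union> S)"

text \<open>
  Primality (non-unit, Euclid's property, non-zero) is relative to the subring A: units and
  divisibility are those of A, not those of C[x,y].  The empty product 1 is allowed.
\<close>

definition product_of_primes_in :: "cpoly2 set \<Rightarrow> cpoly2 \<Rightarrow> bool" where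
  "product_of_primes_in A v \<longleftrightarrow>
     (\<exists>ps. (\<forall>p \<in> set ps. p \<in> A \<and> ring_prime\<^bsub>Cxy\<lparr>carrier := A\<rparr>\<^esub> p) \<and> v = prod_list ps)"

end

theory Submission
  imports Defs
begin

text \<open>
  Write \<open>p = F x\<close>, \<open>q = F y\<close> and \<open>B = C[p,q,x]\<close>. A prime \<open>w\<close> of \<open>B\<close> has a prime factor \<open>f\<close> in
  \<open>C[x,y]\<close>. If the ideal \<open>f C[x,y] \<inter> B\<close> were larger than \<open>w B\<close>, it would be maximal in \<open>B\<close>, so
  \<open>x\<close>, \<open>p\<close>, \<open>q\<close> would be constant modulo \<open>f\<close>; then \<open>f\<close> does not involve \<open>y\<close> and divides the
  Jacobian, which is absurd. Hence \<open>w a \<in> B\<close> implies \<open>a \<in> B\<close>, and cancelling the primes of \<open>v\<close> from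
  \<open>v y = u\<close> gives \<open>y \<in> B\<close>. Now \<open>C[x,y] = C[p,q][x]\<close> is a simple extension which is unramified by
  the Jacobian condition, so the equation of \<open>x\<close> over \<open>C[p,q]\<close> has a constant derivative and is
  therefore linear.
\<close>

section \<open>Ring homomorphisms and substitution into polynomials\<close>

locale class_ring_hom =
  fixes \<phi> :: "'a::comm_ring_1 \<Rightarrow> 'b::comm_ring_1"
  assumes hom_add: "\<phi> (a + b) = \<phi> a + \<phi> b"
    and hom_mult: "\<phi> (a * b) = \<phi> a * \<phi> b"
    and hom_one: "\<phi> 1 = 1"
begin

lemma hom_zero: "\<phi> 0 = 0"
  using hom_add[of 0 0] by simp

lemma hom_uminus: "\<phi> (- a) = - \<phi> a"
  using hom_add[of a "- a"] hom_zero by (simp add: add_eq_0_iff)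

lemma hom_diff: "\<phi> (a - b) = \<phi> a - \<phi> b"
  using hom_add[of a "- b"] hom_uminus by simp

lemma hom_power: "\<phi> (a ^ n) = \<phi> a ^ n"
  by (induction n) (simp_all add: hom_one hom_mult)

lemma hom_sum: "\<phi> (sum f I) = (\<Sum>i\<in>I. \<phi> (f i))"
  by (induction I rule: infinite_finite_induct) (simp_all add: hom_zero hom_add)

lemma hom_prod_mset: "\<phi> (prod_mset M) = prod_mset (image_mset \<phi> M)"
  by (induction M) (simp_all add: hom_one hom_mult)

lemma hom_dvd: "a dvd b \<Longrightarrow> \<phi> a dvd \<phi> b"
  by (auto simp: dvd_def hom_mult)

end

text \<open>\<open>\<phi>\<close> may be any function, because the chain rule below also maps
  coefficients by \<open>\<lambda>c. D (\<phi> c)\<close>, which in general is not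
  multiplicative.\<close>

definition subst_poly :: "('a::comm_ring_1 \<Rightarrow> 'b::comm_ring_1) \<Rightarrow> 'b \<Rightarrow> 'a poly \<Rightarrow> 'b" where
  "subst_poly \<phi> a f = poly (map_poly \<phi> f) a"

lemma subst_poly_0 [simp]: "subst_poly \<phi> a 0 = 0"
  by (simp add: subst_poly_def)

context class_ring_hom
begin

lemma subst_poly_pCons: "subst_poly \<phi> a (pCons c f) = \<phi> c + a * subst_poly \<phi> a f"
  by (simp add: subst_poly_def map_poly_pCons hom_zero)

lemma subst_poly_const: "subst_poly \<phi> a [:c:] = \<phi> c"
  by (simp add: subst_poly_pCons)

lemma subst_poly_monom: "subst_poly \<phi> a (monom c n) = \<phi> c * a ^ n"
  by (simp add: subst_poly_def map_poly_monom hom_zero poly_monom)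

lemma subst_poly_add: "subst_poly \<phi> a (f + g) = subst_poly \<phi> a f + subst_poly \<phi> a g"
proof (induction f arbitrary: g)
  case (pCons c f)
  obtain d g' where g: "g = pCons d g'" by (cases g)
  show ?case
    by (simp add: g subst_poly_pCons hom_add pCons.IH algebra_simps)
qed simp

lemma subst_poly_smult: "subst_poly \<phi> a (smult c f) = \<phi> c * subst_poly \<phi> a f"
  by (induction f) (simp_all add: subst_poly_pCons hom_mult algebra_simps)

lemma subst_poly_mult: "subst_poly \<phi> a (f * g) = subst_poly \<phi> a f * subst_poly \<phi> a g"
  by (induction f)
    (simp_all add: subst_poly_pCons subst_poly_add subst_poly_smult hom_zero algebra_simps)

lemma class_ring_hom_subst_poly: "class_ring_hom (subst_poly \<phi> a)"
  by unfold_locales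
    (simp_all add: subst_poly_add subst_poly_mult subst_poly_const one_pCons hom_one)

lemma hom_subst_poly:
  assumes "class_ring_hom \<psi>"
  shows "\<phi> (subst_poly \<psi> a f) = subst_poly (\<lambda>c. \<phi> (\<psi> c)) (\<phi> a) f"
proof -
  interpret \<psi>: class_ring_hom \<psi> by fact
  interpret \<phi>\<psi>: class_ring_hom "\<lambda>c. \<phi> (\<psi> c)"
    by unfold_locales (simp_all add: \<psi>.hom_add \<psi>.hom_mult \<psi>.hom_one hom_add hom_mult hom_one)
  show ?thesis
    by (induction f)
      (simp_all add: \<psi>.subst_poly_pCons \<phi>\<psi>.subst_poly_pCons hom_add hom_mult hom_zero)
qed

end

section \<open>Derivations, substitution in two variables and the chain rule\<close>

definition derivation :: "('a::comm_ring_1 \<Rightarrow> 'a) \<Rightarrow> bool" where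
  "derivation D \<longleftrightarrow> (\<forall>a b. D (a + b) = D a + D b) \<and> (\<forall>a b. D (a * b) = a * D b + D a * b)"

lemma derivation_0: "derivation D \<Longrightarrow> D 0 = 0"
  unfolding derivation_def by (metis add_cancel_right_right)

text \<open>Leibniz rule on each \<open>\<phi> c * a ^ i\<close>: the first term collects the
  derivatives of the coefficients, the second those of the powers of \<open>a\<close>.\<close>

lemma derivation_subst_poly:
  fixes D :: "'b::idom \<Rightarrow> 'b" and \<phi> :: "'a::idom \<Rightarrow> 'b"
  assumes D: "derivation D" and \<phi>: "class_ring_hom \<phi>"
  shows "D (subst_poly \<phi> a f) =
    subst_poly (\<lambda>c. D (\<phi> c)) a f + subst_poly \<phi> a (pderiv f) * D a"
proof -
  interpret class_ring_hom \<phi> by fact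
  have D0: "D 0 = 0" using derivation_0[OF D] .
  have pC: "subst_poly (\<lambda>c. D (\<phi> c)) a (pCons c f) = D (\<phi> c) + a * subst_poly (\<lambda>c. D (\<phi> c)) a f"
    for c f
    by (simp add: subst_poly_def map_poly_pCons D0 hom_zero)
  show ?thesis
  proof (induction f)
    case 0
    then show ?case by (simp add: D0)
  next
    case (pCons c f)
    then show ?case
      using D
      by (simp add: subst_poly_pCons pC pderiv_pCons subst_poly_add hom_zero derivation_def
          algebra_simps)
  qed
qed

text \<open>The embedding \<open>\<kappa>\<close> of the constants is a parameter because values are
  needed both in C[x,y] and in C[x,y][T].\<close>

definition eval2 :: "(complex \<Rightarrow> 'a::idom) \<Rightarrow> 'a \<Rightarrow> 'a \<Rightarrow> cpoly2 \<Rightarrow> 'a" where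
  "eval2 \<kappa> s t = subst_poly (subst_poly \<kappa> s) t"

lemma class_ring_hom_eval2: "class_ring_hom \<kappa> \<Longrightarrow> class_ring_hom (eval2 \<kappa> s t)"
  unfolding eval2_def by (intro class_ring_hom.class_ring_hom_subst_poly)

lemma eval2_const2: "class_ring_hom \<kappa> \<Longrightarrow> eval2 \<kappa> s t (const2 c) = \<kappa> c"
  by (simp add: eval2_def const2_def class_ring_hom.subst_poly_const
      class_ring_hom.class_ring_hom_subst_poly)

lemma eval2_var_x: "class_ring_hom \<kappa> \<Longrightarrow> eval2 \<kappa> s t var_x = s"
  by (simp add: eval2_def var_x_def class_ring_hom.subst_poly_const
      class_ring_hom.subst_poly_pCons class_ring_hom.hom_zero class_ring_hom.hom_one
      class_ring_hom.class_ring_hom_subst_poly)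

lemma eval2_var_y: "class_ring_hom \<kappa> \<Longrightarrow> eval2 \<kappa> s t var_y = t"
  by (simp add: eval2_def var_y_def class_ring_hom.subst_poly_const
      class_ring_hom.subst_poly_pCons class_ring_hom.hom_zero class_ring_hom.hom_one
      class_ring_hom.class_ring_hom_subst_poly)

lemma eval2_hom:
  assumes "class_ring_hom \<psi>" "class_ring_hom \<kappa>"
  shows "\<psi> (eval2 \<kappa> s t f) = eval2 (\<lambda>c. \<psi> (\<kappa> c)) (\<psi> s) (\<psi> t) f"
  unfolding eval2_def
  by (simp add: class_ring_hom.hom_subst_poly[OF assms(1)] assms
      class_ring_hom.class_ring_hom_subst_poly[OF assms(2)])

lemma class_ring_hom_const2: "class_ring_hom const2"
  by unfold_locales (simp_all add: const2_def one_pCons)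

text \<open>Together with \<open>eval2_hom\<close> this shows that a ring endomorphism fixing the
  constants is substitution of the images of x and y.\<close>

lemma eval2_id: "eval2 const2 var_x var_y f = f"
proof -
  interpret c: class_ring_hom const2 by (rule class_ring_hom_const2)
  interpret s: class_ring_hom "subst_poly const2 var_x" by (rule c.class_ring_hom_subst_poly)
  have *: "subst_poly const2 var_x g = [:g:]" for g
    by (induction g) (simp_all add: c.subst_poly_pCons, simp_all add: const2_def var_x_def)
  show ?thesis
    unfolding eval2_def
  proof (induction f)
    case (pCons c f)
    show ?case
      unfolding s.subst_poly_pCons pCons.IH using *[of c] by (simp add: var_y_def)
  qed simp
qed

lemma coeff_partial_x: "coeff (partial_x f) n = pderiv (coeff f n)"
  by (simp add: partial_x_def coeff_map_poly)

lemma derivation_pderiv: "derivation (pderiv :: 'a::idom poly \<Rightarrow> _)"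
  by (simp add: derivation_def pderiv_add pderiv_mult)

lemma derivation_partial_y: "derivation partial_y"
  using derivation_pderiv by (simp add: partial_y_def[abs_def])

lemma pderiv_sum: "pderiv (sum f I) = (\<Sum>i\<in>I. pderiv (f i))"
  by (induction I rule: infinite_finite_induct) (simp_all add: pderiv_add)

lemma derivation_partial_x: "derivation partial_x"
proof -
  have "partial_x (f * g) = f * partial_x g + partial_x f * g" for f g
    by (rule poly_eqI)
      (simp add: coeff_partial_x coeff_mult pderiv_sum pderiv_mult sum.distrib mult.commute[of "pderiv _"])
  moreover have "partial_x (f + g) = partial_x f + partial_x g" for f g
    by (rule poly_eqI) (simp add: coeff_partial_x pderiv_add)
  ultimately show ?thesis by (simp add: derivation_def)
qed

text \<open>Chain rule in two variables, from \<open>derivation_subst_poly\<close> once per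
  variable. It serves for both partial derivatives and for d/dT on C[x,y][T].\<close>

lemma derivation_eval2:
  assumes D: "derivation D" and \<kappa>: "class_ring_hom \<kappa>" and D\<kappa>: "\<And>c. D (\<kappa> c) = 0"
  shows "D (eval2 \<kappa> s t f) =
    eval2 \<kappa> s t (partial_x f) * D s + eval2 \<kappa> s t (partial_y f) * D t"
proof -
  interpret \<kappa>: class_ring_hom \<kappa> by fact
  interpret s: class_ring_hom "subst_poly \<kappa> s" by (rule \<kappa>.class_ring_hom_subst_poly)
  have [simp]: "subst_poly (\<lambda>c. 0) s g = 0" for g :: "complex poly"
    by (induction g) (simp_all add: subst_poly_def map_poly_pCons)
  have *: "D (subst_poly \<kappa> s c) = subst_poly \<kappa> s (pderiv c) * D s" for c
    using derivation_subst_poly[OF D \<kappa>] by (simp add: D\<kappa>)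
  have "subst_poly (\<lambda>c. subst_poly \<kappa> s (pderiv c) * D s) t f =
      subst_poly (subst_poly \<kappa> s) t (partial_x f) * D s"
  proof (induction f)
    case (pCons c f)
    have "partial_x (pCons c f) = pCons (pderiv c) (partial_x f)"
      by (simp add: partial_x_def map_poly_pCons)
    moreover have "subst_poly (\<lambda>c. subst_poly \<kappa> s (pderiv c) * D s) t (pCons c f) =
       subst_poly \<kappa> s (pderiv c) * D s + t * subst_poly (\<lambda>c. subst_poly \<kappa> s (pderiv c) * D s) t f"
      by (simp add: subst_poly_def map_poly_pCons)
    ultimately show ?case
      using pCons by (simp add: s.subst_poly_pCons algebra_simps)
  qed (simp add: partial_x_def)
  then show ?thesis
    using derivation_subst_poly[OF D s.class_ring_hom_axioms, of t f]
    by (simp add: eval2_def * partial_y_def)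
qed

lemma partials_const2: "partial_x (const2 c) = 0" "partial_y (const2 c) = 0"
  by (simp_all add: partial_x_def partial_y_def const2_def map_poly_pCons pderiv_pCons)

lemma const2_eq_0_iff: "const2 c = 0 \<longleftrightarrow> c = 0"
  by (simp add: const2_def)

lemma is_unit_cpoly2_iff: "is_unit f \<longleftrightarrow> (\<exists>c. c \<noteq> 0 \<and> f = const2 c)"
  by (auto simp: is_unit_poly_iff const2_def dvd_field_iff)

section \<open>The Jacobian criterion for algebraic independence\<close>

text \<open>Differentiating a relation by x and by y gives a linear system with determinant
  \<open>Jac p q\<close>, so both partials of a relation are again relations. In characteristic 0
  this lowers the degree until a nonzero constant would be a relation.\<close>

lemma eval2_inject_if_Jac_nonzero:
  assumes Jac: "Jac p q \<noteq> 0" and "eval2 const2 p q f = 0"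
  shows "f = 0"
proof -
  let ?E = "eval2 const2 p q"
  interpret c: class_ring_hom const2 by (rule class_ring_hom_const2)
  interpret s: class_ring_hom "subst_poly const2 p" by (rule c.class_ring_hom_subst_poly)
  have partials: "?E (partial_x g) = 0 \<and> ?E (partial_y g) = 0" if g: "?E g = 0" for g
  proof -
    have x: "?E (partial_x g) * partial_x p + ?E (partial_y g) * partial_x q = 0"
      using derivation_eval2[OF derivation_partial_x c.class_ring_hom_axioms, of p q g]
      by (simp add: partials_const2 g derivation_0[OF derivation_partial_x])
    have y: "?E (partial_x g) * partial_y p + ?E (partial_y g) * partial_y q = 0"
      using derivation_eval2[OF derivation_partial_y c.class_ring_hom_axioms, of p q g]
      by (simp add: partials_const2 g derivation_0[OF derivation_partial_y])
    \<comment> \<open>Cramer's rule: the combination eliminates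
      \<open>?E (partial_y g)\<close>.\<close>
    have "?E (partial_x g) * Jac p q =
        (?E (partial_x g) * partial_x p + ?E (partial_y g) * partial_x q) * partial_y q -
        (?E (partial_x g) * partial_y p + ?E (partial_y g) * partial_y q) * partial_x q"
      by (simp add: Jac_def algebra_simps)
    then have 1: "?E (partial_x g) * Jac p q = 0" using x y by simp
    have "?E (partial_y g) * Jac p q =
        (?E (partial_x g) * partial_y p + ?E (partial_y g) * partial_y q) * partial_x p -
        (?E (partial_x g) * partial_x p + ?E (partial_y g) * partial_x q) * partial_y p"
      by (simp add: Jac_def algebra_simps)
    then have 2: "?E (partial_y g) * Jac p q = 0" using x y by simp
    show ?thesis using 1 2 Jac by simp
  qed
  \<comment> \<open>Relations free of the second variable are excluded first; the later induction on
    the degree in that variable ends with them.\<close>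
  have const: "g = 0" if "?E [:g:] = 0" for g
    using that
  proof (induction "degree g" arbitrary: g rule: less_induct)
    case less
    have "partial_x [:g:] = [:pderiv g:]" by (simp add: partial_x_def map_poly_pCons)
    then have *: "?E [:pderiv g:] = 0" using partials[OF less.prems] by simp
    have "degree g = 0"
    proof (rule ccontr)
      assume "degree g \<noteq> 0"
      then have "degree (pderiv g) < degree g" by (simp add: degree_pderiv)
      from less.hyps[OF this *] \<open>degree g \<noteq> 0\<close> show False by (simp add: pderiv_eq_0_iff)
    qed
    then obtain c where "g = [:c:]" by (metis degree_eq_zeroE)
    with less.prems show ?case
      by (simp add: eval2_def s.subst_poly_const c.subst_poly_const const2_eq_0_iff)
  qed
  show ?thesis
    using assms(2)
  proof (induction "degree f" arbitrary: f rule: less_induct)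
    case less
    have *: "?E (pderiv f) = 0" using partials[OF less.prems] by (simp add: partial_y_def)
    have "degree f = 0"
    proof (rule ccontr)
      assume "degree f \<noteq> 0"
      then have "degree (pderiv f) < degree f" by (simp add: degree_pderiv)
      from less.hyps[OF this *] \<open>degree f \<noteq> 0\<close> show False by (simp add: pderiv_eq_0_iff)
    qed
    then obtain g where "f = [:g:]" by (metis degree_eq_zeroE)
    with less.prems const show ?case by simp
  qed
qed

section \<open>Algebraic dependence of three polynomials in two variables\<close>

text \<open>A family is used instead of a set: if two indices give the same vector, the difference
  of these two members is already a nontrivial relation.\<close>

lemma (in vector_space) nontrivial_relation_if_card_less:
  assumes "finite T" "finite I" "b ` I \<subseteq> span T" "card T < card I"
  obtains c where "\<exists>i\<in>I. c i \<noteq> 0" "(\<Sum>i\<in>I. scale (c i) (b i)) = 0"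
proof (cases "inj_on b I")
  case True
  then have "card (b ` I) = card I" by (rule card_image)
  then have "dependent (b ` I)"
    using independent_span_bound[OF assms(1) _ assms(3)] assms(4) by auto
  then obtain w where w: "\<exists>v\<in>b ` I. w v \<noteq> 0" "(\<Sum>v\<in>b ` I. scale (w v) v) = 0"
    using dependent_finite[of "b ` I"] assms(2) by auto
  show ?thesis
    using w by (intro that[of "w \<circ> b"]) (auto simp: sum.reindex[OF True])
next
  case False
  then obtain i j where ij: "i \<in> I" "j \<in> I" "i \<noteq> j" "b i = b j" by (auto simp: inj_on_def)
  let ?c = "\<lambda>k. (if k = i then 1 else 0) - (if k = j then 1 else 0)"
  have "(\<Sum>k\<in>I. scale (?c k) (b k)) =
      (\<Sum>k\<in>I. (if k = i then b k else 0) - (if k = j then b k else 0))"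
    by (intro sum.cong) auto
  also have "\<dots> = 0" using ij assms(2) by (simp add: sum_subtractf)
  finally show ?thesis using ij by (intro that[of ?c]) auto
qed

text \<open>Bounding each variable separately makes the bounds add under products, and (m+1)^2
  monomials span everything within the bound \<open>m\<close>.\<close>

definition bidegree_le :: "nat \<Rightarrow> 'a::idom poly poly \<Rightarrow> bool" where
  "bidegree_le m f \<longleftrightarrow> degree f \<le> m \<and> (\<forall>i. degree (coeff f i) \<le> m)"

lemma bidegree_le_mono: "bidegree_le m f \<Longrightarrow> m \<le> n \<Longrightarrow> bidegree_le n f"
  unfolding bidegree_le_def by (meson order.trans)

lemma bidegree_le_exists: "\<exists>m. bidegree_le m f"
proof -
  let ?m = "Max (insert (degree f) ((\<lambda>i. degree (coeff f i)) ` {..degree f}))"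
  have "degree f \<le> ?m" by (rule Max_ge) auto
  moreover have "degree (coeff f i) \<le> ?m" for i
  proof (cases "i \<le> degree f")
    case True
    then show ?thesis by (intro Max_ge) auto
  qed (simp add: coeff_eq_0)
  ultimately show ?thesis unfolding bidegree_le_def by blast
qed

lemma bidegree_le_mult:
  assumes "bidegree_le m f" "bidegree_le n g"
  shows "bidegree_le (m + n) (f * g)"
proof -
  have "degree (coeff (f * g) k) \<le> m + n" for k
    unfolding coeff_mult
  proof (rule degree_sum_le)
    fix i
    show "degree (coeff f i * coeff g (k - i)) \<le> m + n"
      using assms unfolding bidegree_le_def
      by (intro order.trans[OF degree_mult_le] add_mono) auto
  qed simp
  moreover have "degree (f * g) \<le> m + n"
    using assms degree_mult_le[of f g] unfolding bidegree_le_def by linarith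
  ultimately show ?thesis by (simp add: bidegree_le_def)
qed

lemma bidegree_le_power: "bidegree_le m f \<Longrightarrow> bidegree_le (n * m) (f ^ n)"
proof (induction n)
  case 0
  show ?case by (simp add: bidegree_le_def one_pCons coeff_pCons split: nat.splits)
next
  case (Suc n)
  then show ?case using bidegree_le_mult[of m f "n * m" "f ^ n"] by simp
qed

text \<open>C acts through \<open>[:c:]\<close> because \<open>smult\<close> on C[x][y] takes
  scalars from C[x].\<close>

interpretation cpoly2: vector_space "\<lambda>c. smult [:c:] :: cpoly2 \<Rightarrow> cpoly2"
proof
  show "smult [:1:] f = f" for f :: cpoly2
    by (metis one_pCons smult_1_left)
qed (simp_all add: smult_add_right mult.commute flip: smult_add_left)

lemma bidegree_le_span:
  fixes f :: cpoly2
  assumes "bidegree_le m f"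
  shows "f \<in> cpoly2.span ((\<lambda>(i, j). monom (monom 1 i) j) ` ({..m} \<times> {..m}))"
proof -
  have *: "coeff f j = (\<Sum>i\<le>m. monom (coeff (coeff f j) i) i)" for j
    using assms by (intro poly_as_sum_of_monoms'[symmetric]) (simp add: bidegree_le_def)
  have "f = (\<Sum>j\<le>m. monom (coeff f j) j)"
    using assms by (intro poly_as_sum_of_monoms'[symmetric]) (simp add: bidegree_le_def)
  also have "\<dots> = (\<Sum>j\<le>m. \<Sum>i\<le>m. smult [:coeff (coeff f j) i:] (monom (monom 1 i) j))"
  proof (intro sum.cong refl)
    fix j
    have "monom (coeff f j) j = monom (\<Sum>i\<le>m. monom (coeff (coeff f j) i) i) j"
      using *[of j] by simp
    also have "\<dots> = (\<Sum>i\<le>m. monom (monom (coeff (coeff f j) i) i) j)"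
      by (rule poly_eqI) (simp add: coeff_sum)
    finally show "monom (coeff f j) j =
        (\<Sum>i\<le>m. smult [:coeff (coeff f j) i:] (monom (monom 1 i) j))"
      by (simp add: smult_monom)
  qed
  finally have f: "f = (\<Sum>j\<le>m. \<Sum>i\<le>m. smult [:coeff (coeff f j) i:] (monom (monom 1 i) j))" .
  show ?thesis
    by (subst f) (intro cpoly2.span_sum cpoly2.span_scale cpoly2.span_base, auto)
qed

text \<open>The outer variable stands for \<open>r\<close> and the coefficients for polynomials in
  \<open>p\<close> and \<open>q\<close>, so a relation reads as an equation for \<open>r\<close>
  over C[p,q].\<close>

definition eval3 :: "cpoly2 \<Rightarrow> cpoly2 \<Rightarrow> cpoly2 \<Rightarrow> cpoly2 poly \<Rightarrow> cpoly2" where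
  "eval3 p q r = subst_poly (eval2 const2 p q) r"

lemma class_ring_hom_eval3: "class_ring_hom (eval3 p q r)"
  unfolding eval3_def
  by (intro class_ring_hom.class_ring_hom_subst_poly class_ring_hom_eval2 class_ring_hom_const2)

lemma eval3_pCons: "eval3 p q r (pCons c f) = eval2 const2 p q c + r * eval3 p q r f"
  unfolding eval3_def
  by (intro class_ring_hom.subst_poly_pCons class_ring_hom_eval2 class_ring_hom_const2)

lemma eval3_monom:
  "eval3 p q r (monom (monom (monom c i) j) k) = smult [:c:] (p ^ i * q ^ j * r ^ k)"
proof -
  interpret c: class_ring_hom const2 by (rule class_ring_hom_const2)
  interpret s: class_ring_hom "subst_poly const2 p" by (rule c.class_ring_hom_subst_poly)
  interpret t: class_ring_hom "subst_poly (subst_poly const2 p) q"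
    by (rule s.class_ring_hom_subst_poly)
  show ?thesis
    by (simp add: eval3_def eval2_def c.subst_poly_monom s.subst_poly_monom t.subst_poly_monom
        const2_def)
qed

text \<open>There are more monomials in three variables of exponents at most \<open>N\<close> than in two
  variables of exponents at most a fixed multiple of \<open>N\<close>.\<close>

lemma algebraically_dependent:
  obtains f where "f \<noteq> 0" "eval3 p q r f = 0"
proof -
  obtain m1 m2 m3 where m: "bidegree_le m1 p" "bidegree_le m2 q" "bidegree_le m3 r"
    using bidegree_le_exists by blast
  define d where "d = m1 + m2 + m3"
  \<comment> \<open>This choice gives (N d + 1)^2 <= ((N+1)(d+1))^2 = (N+1)^2 N < (N+1)^3.\<close>
  define N where "N = (d + 1) ^ 2"
  define I where "I = {..N} \<times> {..N} \<times> {..N}"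
  define b where "b = (\<lambda>(i, j, k). p ^ i * q ^ j * r ^ k)"
  define T where "T = (\<lambda>(i, j). monom (monom 1 i) j :: cpoly2) ` ({..N * d} \<times> {..N * d})"
  have "b ` I \<subseteq> cpoly2.span T"
  proof safe
    fix i j k assume "(i, j, k) \<in> I"
    then have ijk: "i \<le> N" "j \<le> N" "k \<le> N" by (auto simp: I_def)
    have "bidegree_le (i * m1 + j * m2 + k * m3) (b (i, j, k))"
      unfolding b_def by (auto intro!: bidegree_le_mult bidegree_le_power m)
    moreover have "i * m1 + j * m2 + k * m3 \<le> N * d"
      using ijk by (simp add: d_def distrib_left add_mono)
    ultimately show "b (i, j, k) \<in> cpoly2.span T"
      unfolding T_def using bidegree_le_mono by (intro bidegree_le_span) blast
  qed
  moreover have "card T < card I"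
  proof -
    have "card T \<le> (N * d + 1) * (N * d + 1)"
      unfolding T_def by (rule order.trans[OF card_image_le]) auto
    also have "\<dots> \<le> ((N + 1) * (d + 1)) * ((N + 1) * (d + 1))"
      by (intro mult_le_mono) auto
    also have "\<dots> = (N + 1) * (N + 1) * ((d + 1) * (d + 1))" by (simp only: mult_ac)
    also have "\<dots> = (N + 1) * (N + 1) * N" by (simp only: N_def power2_eq_square)
    also have "\<dots> < (N + 1) * (N + 1) * (N + 1)" by simp
    also have "\<dots> = card I" by (simp add: I_def card_cartesian_product)
    finally show ?thesis .
  qed
  moreover have "finite T" "finite I" by (auto simp: T_def I_def)
  ultimately obtain c where c: "\<exists>x\<in>I. c x \<noteq> 0" "(\<Sum>x\<in>I. smult [:c x:] (b x)) = 0"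
    using cpoly2.nontrivial_relation_if_card_less[of T I b] by blast
  define f where "f = (\<Sum>x\<in>I. case x of (i, j, k) \<Rightarrow> monom (monom (monom (c x) i) j) k)"
  interpret e: class_ring_hom "eval3 p q r" by (rule class_ring_hom_eval3)
  have "eval3 p q r f = (\<Sum>x\<in>I. smult [:c x:] (b x))"
    unfolding f_def e.hom_sum
    by (intro sum.cong) (auto simp: eval3_monom b_def)
  with c have "eval3 p q r f = 0" by simp
  moreover have "f \<noteq> 0"
  proof -
    from c obtain i j k where ijk: "(i, j, k) \<in> I" "c (i, j, k) \<noteq> 0" by auto
    \<comment> \<open>Distinct triples give distinct monomials, so this position of \<open>f\<close>
      sees only one term.\<close>
    have "coeff (coeff (coeff f k) j) i = (\<Sum>x\<in>I. if x = (i, j, k) then c x else 0)"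
      unfolding f_def coeff_sum by (intro sum.cong) (auto split: if_splits)
    also have "\<dots> = c (i, j, k)" using ijk \<open>finite I\<close> by simp
    finally show ?thesis using ijk by auto
  qed
  ultimately show ?thesis using that by blast
qed

section \<open>Subalgebras of C[x,y] and their generators\<close>

lemma Cxy_simps [simp]:
  "carrier Cxy = UNIV" "a \<otimes>\<^bsub>Cxy\<^esub> b = a * b" "a \<oplus>\<^bsub>Cxy\<^esub> b = a + b" "\<one>\<^bsub>Cxy\<^esub> = 1" "\<zero>\<^bsub>Cxy\<^esub> = 0"
  by (simp_all add: Cxy_def ring_of_type_algebra_def)

lemma a_inv_Cxy [simp]: "\<ominus>\<^bsub>Cxy\<^esub> a = - a"
proof -
  interpret cring Cxy unfolding Cxy_def by (rule cring_from_type_algebra)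
  show ?thesis by (rule sum_zero_eq_neg[symmetric]) simp_all
qed

locale C_subalgebra_set =
  fixes B :: "cpoly2 set"
  assumes const_mem: "const2 c \<in> B"
    and add_mem: "a \<in> B \<Longrightarrow> b \<in> B \<Longrightarrow> a + b \<in> B"
    and mult_mem: "a \<in> B \<Longrightarrow> b \<in> B \<Longrightarrow> a * b \<in> B"
begin

lemma zero_mem: "0 \<in> B"
  using const_mem[of 0] by (simp add: const2_def)

lemma power_mem: "a \<in> B \<Longrightarrow> a ^ n \<in> B"
  using const_mem[of 1] by (induction n) (auto simp: const2_def one_pCons intro: mult_mem)

lemma uminus_mem: "a \<in> B \<Longrightarrow> - a \<in> B"
  using mult_mem[OF const_mem[of "-1"], of a] by (simp add: const2_def)

lemma eval1_mem: "p \<in> B \<Longrightarrow> subst_poly const2 p f \<in> B"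
  by (induction f)
    (auto simp: class_ring_hom.subst_poly_pCons[OF class_ring_hom_const2] zero_mem
      intro: add_mem mult_mem const_mem)

lemma eval2_mem: "p \<in> B \<Longrightarrow> q \<in> B \<Longrightarrow> eval2 const2 p q f \<in> B"
  unfolding eval2_def
  by (induction f)
    (auto simp: class_ring_hom.subst_poly_pCons[OF class_ring_hom.class_ring_hom_subst_poly,
        OF class_ring_hom_const2] zero_mem intro: add_mem mult_mem eval1_mem)

lemma eval3_mem: "p \<in> B \<Longrightarrow> q \<in> B \<Longrightarrow> r \<in> B \<Longrightarrow> eval3 p q r f \<in> B"
proof (induction f)
  case 0
  then show ?case by (simp add: eval3_def zero_mem)
qed (auto simp: eval3_pCons intro: add_mem mult_mem eval2_mem)

end

lemma C_subalgebra_set_C_subalgebra: "C_subalgebra_set (C_subalgebra S)"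
proof
  fix a b
  assume ab: "a \<in> C_subalgebra S" "b \<in> C_subalgebra S"
  show "a + b \<in> C_subalgebra S"
    using generate_ring.eng_add[OF ab[unfolded C_subalgebra_def]] by (simp add: C_subalgebra_def)
  show "a * b \<in> C_subalgebra S"
    using generate_ring.eng_mult[OF ab[unfolded C_subalgebra_def]] by (simp add: C_subalgebra_def)
qed (auto simp: C_subalgebra_def intro: generate_ring.incl)

lemma C_subalgebra_incl: "S \<subseteq> C_subalgebra S"
  by (auto simp: C_subalgebra_def intro: generate_ring.incl)

lemma C_subalgebra_minimal:
  assumes "C_subalgebra_set B" "S \<subseteq> B"
  shows "C_subalgebra S \<subseteq> B"
proof
  interpret C_subalgebra_set B by fact
  fix h assume "h \<in> C_subalgebra S"
  then show "h \<in> B"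
    unfolding C_subalgebra_def
  proof (induction rule: generate_ring.induct)
    case one
    show ?case using const_mem[of 1] by (simp add: const2_def one_pCons)
  qed (use assms(2) in \<open>auto intro: const_mem add_mem mult_mem uminus_mem\<close>)
qed

lemma C_subalgebra_set_range:
  assumes "class_ring_hom \<phi>" "\<And>c. const2 c \<in> range \<phi>"
  shows "C_subalgebra_set (range \<phi>)"
proof -
  interpret class_ring_hom \<phi> by fact
  show ?thesis using assms(2) by unfold_locales (auto simp flip: hom_add hom_mult)
qed

text \<open>Turns membership in the inductively generated subalgebra into an explicit polynomial in
  the generators.\<close>

lemma C_subalgebra_triple: "C_subalgebra {p, q, r} = range (eval3 p q r)"
proof
  interpret e: class_ring_hom "eval3 p q r" by (rule class_ring_hom_eval3)
  have B: "C_subalgebra_set (range (eval3 p q r))"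
  proof (rule C_subalgebra_set_range[OF e.class_ring_hom_axioms])
    fix c
    have "eval3 p q r [:const2 c:] = const2 c"
      by (simp add: eval3_pCons eval2_const2[OF class_ring_hom_const2])
        (simp add: eval3_def)
    then show "const2 c \<in> range (eval3 p q r)" by (metis rangeI)
  qed
  have "eval3 p q r [:var_x:] = p" "eval3 p q r [:var_y:] = q" "eval3 p q r [:0, 1:] = r"
    by (simp_all add: eval3_pCons eval2_var_x[OF class_ring_hom_const2]
        eval2_var_y[OF class_ring_hom_const2]
        class_ring_hom.hom_one[OF class_ring_hom_eval2[OF class_ring_hom_const2]]
        class_ring_hom.hom_zero[OF class_ring_hom_eval2[OF class_ring_hom_const2]])
      (simp_all add: eval3_def)
  then have "{p, q, r} \<subseteq> range (eval3 p q r)" by (metis insert_subset empty_subsetI rangeI)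
  then show "C_subalgebra {p, q, r} \<subseteq> range (eval3 p q r)" by (rule C_subalgebra_minimal[OF B])
  interpret C: C_subalgebra_set "C_subalgebra {p, q, r}" by (rule C_subalgebra_set_C_subalgebra)
  show "range (eval3 p q r) \<subseteq> C_subalgebra {p, q, r}"
    using C_subalgebra_incl[of "{p, q, r}"] by (auto intro: C.eval3_mem)
qed

section \<open>Prime elements of the subalgebra and cancellation\<close>

text \<open>For dividing a relation by the powers of \<open>w\<close> and \<open>g\<close> that it
  contains, leaving a nonzero constant coefficient.\<close>

lemma poly_eq_power_mult_nonzero_const:
  assumes "f \<noteq> (0 :: 'a::idom poly)"
  obtains n g c where "c \<noteq> 0" "f = [:0, 1:] ^ n * pCons c g"
proof -
  have "\<exists>n c g. c \<noteq> 0 \<and> f = [:0, 1:] ^ n * pCons c g"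
    using assms
  proof (induction f)
    case (pCons a f)
    show ?case
    proof (cases "a = 0")
      case True
      then obtain n c g where "c \<noteq> 0" "f = [:0, 1:] ^ n * pCons c g" using pCons by auto
      then show ?thesis using True by (intro exI[of _ "Suc n"] exI[of _ c] exI[of _ g]) simp
    next
      case False
      then show ?thesis by (intro exI[of _ 0] exI[of _ a] exI[of _ f]) simp
    qed
  qed simp
  then show ?thesis using that by blast
qed

text \<open>Over C, \<open>h\<close> is a unit times linear factors, and the prime \<open>f\<close>
  must divide the value of one of these factors at \<open>z\<close>.\<close>

lemma prime_dvd_eval1_imp_dvd_diff_const:
  assumes f: "prime_elem f" and "h \<noteq> 0" "f dvd subst_poly const2 z h"
  shows "\<exists>c. f dvd z - const2 c"
  using assms(2,3)
proof (induction "degree h" arbitrary: h rule: less_induct)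
  case less
  interpret c: class_ring_hom const2 by (rule class_ring_hom_const2)
  show ?case
  proof (cases "degree h = 0")
    case True
    then obtain a where a: "h = [:a:]" by (metis degree_eq_zeroE)
    then have "a \<noteq> 0" using less.prems by simp
    then have "is_unit (const2 a)" using is_unit_cpoly2_iff by blast
    moreover have "f dvd const2 a" using less.prems a by (simp add: c.subst_poly_const)
    ultimately show ?thesis using f dvd_trans prime_elem_not_unit by blast
  next
    case False
    then obtain a where "poly h a = 0"
      using fundamental_theorem_of_algebra[of h] by (auto simp: constant_degree)
    then obtain h' where h': "h = [:-a, 1:] * h'" by (metis dvdE poly_eq_0_iff_dvd)
    with less.prems have "h' \<noteq> 0" by auto
    then have deg: "degree h' < degree h" unfolding h' by (subst degree_mult_eq) auto
    have "subst_poly const2 z [:-a, 1:] = z - const2 a"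
      by (simp add: c.subst_poly_pCons c.hom_one c.hom_uminus)
    then have "subst_poly const2 z h = (z - const2 a) * subst_poly const2 z h'"
      unfolding h' c.subst_poly_mult by simp
    with less.prems(2) have "f dvd z - const2 a \<or> f dvd subst_poly const2 z h'"
      using prime_elem_dvd_mult_iff[OF f] by metis
    then show ?thesis using less.hyps[OF deg \<open>h' \<noteq> 0\<close>] by auto
  qed
qed

text \<open>The elementwise form that \<open>ring_prime\<close> with carrier \<open>B\<close>
  yields; divisibility by \<open>w\<close> within \<open>B\<close> is membership in the ideal w
  B.\<close>

definition prime_in :: "cpoly2 set \<Rightarrow> cpoly2 \<Rightarrow> bool" where
  "prime_in B w \<longleftrightarrow> w \<in> B \<and> w \<noteq> 0 \<and> (\<forall>k\<in>B. w * k \<noteq> 1) \<and>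
    (\<forall>a\<in>B. \<forall>b\<in>B. a * b \<in> (*) w ` B \<longrightarrow> a \<in> (*) w ` B \<or> b \<in> (*) w ` B)"

lemma prime_in_if_ring_prime:
  assumes "w \<in> B" "ring_prime\<^bsub>Cxy\<lparr>carrier := B\<rparr>\<^esub> w"
  shows "prime_in B w"
  using assms
  unfolding prime_in_def ring_prime_def Divisibility.prime_def factor_def Units_def image_iff
  by (auto simp: mult.commute)

context C_subalgebra_set
begin

lemma prime_in_power:
  assumes w: "prime_in B w" and "g \<in> B" "g \<notin> (*) w ` B" "a \<in> B" "g ^ n * a \<in> (*) w ` B"
  shows "a \<in> (*) w ` B"
  using assms(5)
proof (induction n)
  case (Suc n)
  have "g * (g ^ n * a) \<in> (*) w ` B" using Suc.prems by (simp add: mult.assoc)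
  then have "g ^ n * a \<in> (*) w ` B"
    using w assms(2-4) mult_mem[OF power_mem[OF assms(2)] assms(4)] unfolding prime_in_def by blast
  then show ?case by (rule Suc.IH)
qed simp

text \<open>For \<open>A = C[x,y]\<close>, the prime \<open>fA \<inter> B\<close> strictly contains the nonzero prime \<open>wB\<close> of the
  two-dimensional ring \<open>B\<close>, hence is maximal. Concretely: a relation between \<open>z\<close>, \<open>g\<close>, \<open>w\<close> may be divided by \<open>w\<close> and
  then, modulo \<open>w\<close>, by \<open>g\<close>, so that modulo \<open>f\<close> a nonzero polynomial in \<open>z\<close> alone remains.\<close>

lemma prime_in_const_mod:
  assumes w: "prime_in B w" and f: "prime_elem f" "f dvd w"
    and g: "g \<in> B" "f dvd g" "g \<notin> (*) w ` B" and z: "z \<in> B"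
  shows "\<exists>c. f dvd z - const2 c"
proof -
  interpret c: class_ring_hom const2 by (rule class_ring_hom_const2)
  interpret s: class_ring_hom "subst_poly const2 z" by (rule c.class_ring_hom_subst_poly)
  interpret t: class_ring_hom "eval2 const2 z g"
    by (rule class_ring_hom_eval2) (rule class_ring_hom_const2)
  interpret e: class_ring_hom "eval3 z g w" by (rule class_ring_hom_eval3)
  have wB: "w \<in> B" "w \<noteq> 0" using w by (auto simp: prime_in_def)
  obtain F where F: "F \<noteq> 0" "eval3 z g w F = 0" by (rule algebraically_dependent)
  from F(1) obtain n \<phi> G where G: "\<phi> \<noteq> 0" "F = [:0, 1:] ^ n * pCons \<phi> G"
    by (rule poly_eq_power_mult_nonzero_const)
  have "eval3 z g w [:0, 1:] = w"
    by (simp add: eval3_pCons t.hom_zero t.hom_one) (simp add: eval3_def)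
  with F(2) wB have "eval3 z g w (pCons \<phi> G) = 0"
    unfolding G(2) e.hom_mult e.hom_power by simp
  then have "eval2 const2 z g \<phi> = w * - eval3 z g w G"
    by (simp add: eval3_pCons add_eq_0_iff2)
  then have \<phi>: "eval2 const2 z g \<phi> \<in> (*) w ` B"
    using uminus_mem[OF eval3_mem[OF z g(1) wB(1)]] by blast
  from G(1) obtain k \<psi> \<theta> where \<psi>: "\<psi> \<noteq> 0" "\<phi> = [:0, 1:] ^ k * pCons \<psi> \<theta>"
    by (rule poly_eq_power_mult_nonzero_const)
  have "eval2 const2 z g [:0, 1:] = g"
    using eval2_var_y[OF class_ring_hom_const2, of z g] by (simp add: var_y_def)
  then have "g ^ k * eval2 const2 z g (pCons \<psi> \<theta>) \<in> (*) w ` B"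
    using \<phi> unfolding \<psi>(2) t.hom_mult t.hom_power by simp
  then have "eval2 const2 z g (pCons \<psi> \<theta>) \<in> (*) w ` B"
    using prime_in_power[OF w g(1,3) eval2_mem[OF z g(1)]] by blast
  \<comment> \<open>Now divisibility moves from \<open>B\<close> to C[x,y]: \<open>f\<close> divides
    \<open>w\<close> and \<open>g\<close>, so modulo \<open>f\<close> only the constant coefficient
    \<open>\<psi>\<close> survives.\<close>
  then have "f dvd eval2 const2 z g (pCons \<psi> \<theta>)" using f(2) by (auto intro: dvd_mult2)
  then have "f dvd subst_poly const2 z \<psi> + g * eval2 const2 z g \<theta>"
    by (simp add: eval2_def s.subst_poly_pCons)
  then have "f dvd subst_poly const2 z \<psi>" using g(2) by (simp add: dvd_add_left_iff)
  then show ?thesis using prime_dvd_eval1_imp_dvd_diff_const f(1) \<psi>(1) by blast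
qed

end

text \<open>A divisor \<open>f\<close> of x - a is free of y, so \<open>partial_y\<close> commutes
  with multiplication by \<open>f\<close>. Hence \<open>f\<close> divides the y-derivatives of
  \<open>p\<close> and \<open>q\<close>, and with them the Jacobian, a unit.\<close>

lemma prime_not_dvd_all_diff_const:
  assumes f: "prime_elem f" and J: "Jac p q = const2 c" "c \<noteq> 0"
  shows "\<not> (f dvd var_x - const2 a \<and> f dvd p - const2 b \<and> f dvd q - const2 d)"
proof
  assume *: "f dvd var_x - const2 a \<and> f dvd p - const2 b \<and> f dvd q - const2 d"
  have "degree f \<le> degree (var_x - const2 a)"
    using * by (intro dvd_imp_degree_le) (auto simp: var_x_def const2_def)
  then have "degree f = 0" by (simp add: var_x_def const2_def)
  then have fy: "partial_y f = 0" by (simp add: partial_y_def pderiv_eq_0_iff)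
  have dvd: "f dvd partial_y h" if "f dvd h - const2 b" for h b
  proof -
    from that obtain k where "h = f * k + const2 b" by (metis dvdE diff_add_cancel)
    then have "partial_y h = f * partial_y k"
      using derivation_partial_y fy partials_const2(2)[of b] unfolding derivation_def by simp
    then show ?thesis by simp
  qed
  have "f dvd Jac p q" unfolding Jac_def using * dvd by (intro dvd_diff) auto
  moreover have "is_unit (const2 c)" using J(2) is_unit_cpoly2_iff by blast
  ultimately show False using f J(1) dvd_trans prime_elem_not_unit by metis
qed

text \<open>If \<open>w * a\<close> were outside w B, it could serve as the \<open>g\<close> of
  \<open>prime_in_const_mod\<close>, making \<open>p\<close>, \<open>q\<close> and x constant modulo
  one prime \<open>f\<close>.\<close>

lemma prime_in_saturated:
  assumes J: "Jac p q = const2 c" "c \<noteq> 0" and B: "B = C_subalgebra {p, q, var_x}"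
    and w: "prime_in B w" and a: "w * a \<in> B"
  shows "a \<in> B"
proof -
  interpret C_subalgebra_set B unfolding B by (rule C_subalgebra_set_C_subalgebra)
  have w0: "w \<noteq> 0" using w by (simp add: prime_in_def)
  \<comment> \<open>The hypothesis concerns units of \<open>B\<close>; it carries over because units
    of C[x,y] are constants, whose inverses lie in \<open>B\<close>.\<close>
  have "\<not> is_unit w"
  proof
    assume "is_unit w"
    then obtain d where "d \<noteq> 0" "w = const2 d" using is_unit_cpoly2_iff by blast
    then have "w * const2 (inverse d) = 1" by (simp add: const2_def one_pCons)
    then show False using w const_mem unfolding prime_in_def by blast
  qed
  then obtain f where "f dvd w" "normalization_semidom_class.prime f"
    using w0 prime_divisor_exists by blast
  then have f: "prime_elem f" "f dvd w" by auto
  have "w * a \<in> (*) w ` B"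
  proof (rule ccontr)
    assume *: "w * a \<notin> (*) w ` B"
    have mem: "p \<in> B" "q \<in> B" "var_x \<in> B"
      unfolding B using C_subalgebra_incl[of "{p, q, var_x}"] by auto
    note const = prime_in_const_mod[OF w f a dvd_mult2[OF f(2)] *]
    show False
      using const[OF mem(1)] const[OF mem(2)] const[OF mem(3)]
        prime_not_dvd_all_diff_const[OF f(1) J] by blast
  qed
  then show ?thesis using w0 by auto
qed

section \<open>Relations over C[p,q] and the simple extension generated by x\<close>

text \<open>Since \<open>p\<close> and \<open>q\<close> are algebraically independent, nonzero
  relations have positive outer degree. A suitable prime factor \<open>h\<close> of one of least
  degree is again one of least degree, so pseudo-division by \<open>h\<close> leaves no
  remainder.\<close>

lemma eval3_kernel_principal:
  assumes J: "Jac p q \<noteq> 0"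
  obtains h where "degree h > 0" "eval3 p q r h = 0"
    "\<And>f. eval3 p q r f = 0 \<Longrightarrow> h dvd f"
proof -
  let ?e = "eval3 p q r"
  interpret e: class_ring_hom ?e by (rule class_ring_hom_eval3)
  have deg0: "f = 0" if "?e f = 0" "degree f = 0" for f
  proof -
    from that(2) obtain g where "f = [:g:]" by (metis degree_eq_zeroE)
    then show ?thesis
      using that(1) eval2_inject_if_Jac_nonzero[OF J, of g]
      by (simp add: eval3_pCons) (simp add: eval3_def)
  qed
  define P where "P = (\<lambda>f. f \<noteq> 0 \<and> ?e f = 0)"
  obtain g0 where "P g0" unfolding P_def using algebraically_dependent by blast
  then obtain g where g: "P g" and least: "\<And>f. P f \<Longrightarrow> degree g \<le> degree f"
    using arg_min_natI[of P g0 degree] arg_min_nat_le[of P _ degree] by blast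
  have "g \<noteq> 0" "?e g = 0" using g by (auto simp: P_def)
  obtain A where A: "\<And>h. h \<in># A \<Longrightarrow> prime_elem h" "normalize (prod_mset A) = normalize g"
    using prime_factorization_exists[OF \<open>g \<noteq> 0\<close>] by auto
  have "g dvd prod_mset A" using A(2) by (metis associatedD1)
  then have "?e (prod_mset A) = 0" using e.hom_dvd \<open>?e g = 0\<close> by fastforce
  \<comment> \<open>The values lie in an integral domain, so some prime factor is itself sent to
    0.\<close>
  then obtain h where h: "h \<in># A" "?e h = 0" by (auto simp: e.hom_prod_mset prod_mset_zero_iff)
  have "h dvd g" using dvd_prod_mset[OF h(1)] A(2) by (metis associatedD2 dvd_trans)
  then have deg: "degree h \<le> degree g" using \<open>g \<noteq> 0\<close> by (rule dvd_imp_degree_le)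
  have prime: "prime_elem h" "h \<noteq> 0" using A(1)[OF h(1)] by auto
  have pos: "degree h > 0" using deg0[OF h(2)] prime by auto
  have "h dvd f" if f: "?e f = 0" for f
  proof -
    \<comment> \<open>The coefficient ring is not a field, so division costs a factor
      \<open>l\<close>. It has outer degree 0, hence the prime \<open>h\<close> cannot divide
      it.\<close>
    obtain s t where st: "pseudo_divmod f h = (s, t)" by fastforce
    define l where "l = coeff h (degree h) ^ (Suc (degree f) - degree h)"
    have div: "smult l f = h * s + t" "t = 0 \<or> degree t < degree h"
      using pseudo_divmod[OF prime(2) st] by (auto simp: l_def)
    have "?e t = ?e ([:l:] * f - h * s)" using div(1) by simp
    also have "\<dots> = 0" unfolding e.hom_diff e.hom_mult using f h(2) by simp
    finally have "t = 0 \<or> P t" by (simp add: P_def)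
    then have "t = 0" using div(2) least[of t] deg by linarith
    then have "h dvd [:l:] * f" using div(1) by simp
    moreover have "\<not> h dvd [:l:]"
    proof
      assume "h dvd [:l:]"
      moreover have "l \<noteq> 0" using prime(2) by (simp add: l_def)
      ultimately show False using pos dvd_imp_degree_le[of h "[:l:]"] by simp
    qed
    ultimately show "h dvd f" using prime_elem_dvd_mult_iff[OF prime(1)] by metis
  qed
  then show ?thesis using that pos h(2) by blast
qed

text \<open>If \<open>h\<close> generates the relations between \<open>p\<close>, \<open>q\<close>, \<open>x\<close> and \<open>y = G(p,q,x)\<close>, then \<open>h\<close> divides
  \<open>P - p(T, G)\<close> and \<open>Q - q(T, G)\<close>. Differentiating by \<open>T\<close> shows that \<open>h'(x)\<close> divides the Jacobian,
  so \<open>h'\<close> is constant.\<close>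

lemma var_x_in_range_if_var_y_in_range_eval3:
  assumes J: "Jac p q = const2 c" "c \<noteq> 0" and G: "var_y = eval3 p q var_x G"
  shows "var_x \<in> range (eval2 const2 p q)"
proof -
  let ?e = "eval3 p q var_x"
  let ?\<kappa> = "\<lambda>c. [:const2 c:]"
  let ?T = "[:0, 1:] :: cpoly2 poly"
  let ?s = "eval2 ?\<kappa> ?T G"
  interpret e: class_ring_hom ?e by (rule class_ring_hom_eval3)
  interpret E: class_ring_hom "eval2 const2 p q"
    by (rule class_ring_hom_eval2) (rule class_ring_hom_const2)
  have \<kappa>: "class_ring_hom ?\<kappa>"
    by unfold_locales (simp_all add: const2_def one_pCons)
  have e_const: "?e [:g:] = eval2 const2 p q g" for g
    by (simp add: eval3_pCons) (simp add: eval3_def)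
  have e_\<kappa>: "?e (?\<kappa> a) = const2 a" for a
    by (simp add: e_const eval2_const2[OF class_ring_hom_const2])
  have e_T: "?e ?T = var_x"
    using e_const[of 1] by (simp add: eval3_pCons[of p q var_x 0] E.hom_zero E.hom_one)
  \<comment> \<open>\<open>?s f\<close> is f(T, G), a lift of \<open>f\<close>, because
    \<open>?e\<close> sends T to x and \<open>G\<close> to y.\<close>
  have e_s: "?e (?s f) = f" for f
    using eval2_hom[OF e.class_ring_hom_axioms \<kappa>, of ?T G f]
    by (simp only: e_\<kappa> e_T G[symmetric] eval2_id)
  have "Jac p q \<noteq> 0" using J by (simp add: const2_eq_0_iff)
  then obtain h where h: "degree h > 0" "?e h = 0" "\<And>f. ?e f = 0 \<Longrightarrow> h dvd f"
    by (rule eval3_kernel_principal) blast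
  have dvd: "?e (pderiv h) dvd partial_x f + partial_y f * ?e (pderiv G)"
    if f: "f \<in> range (eval2 const2 p q)" for f
  proof -
    from f obtain g where "f = ?e [:g:]" by (auto simp: e_const)
    \<comment> \<open>\<open>f\<close> has two lifts, one of them free of T and so killed by d/dT;
      they differ by a multiple of \<open>h\<close>.\<close>
    then have "?e ([:g:] - ?s f) = 0" by (simp only: e.hom_diff e_s diff_self)
    then obtain a where a: "[:g:] - ?s f = h * a" using h(3) by (meson dvdE)
    have "pderiv (?s f) = ?s (partial_x f) + ?s (partial_y f) * pderiv G"
      using derivation_eval2[OF derivation_pderiv \<kappa>, of ?T G f] by (simp add: pderiv_pCons)
    then have "- (?s (partial_x f) + ?s (partial_y f) * pderiv G) = pderiv (h * a)"
      by (simp add: pderiv_diff pderiv_pCons flip: a)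
    also have "\<dots> = h * pderiv a + a * pderiv h" by (rule pderiv_mult)
    finally have "?e (- (?s (partial_x f) + ?s (partial_y f) * pderiv G)) =
        ?e (h * pderiv a + a * pderiv h)" by (rule arg_cong)
    then have "- (partial_x f + partial_y f * ?e (pderiv G)) = ?e a * ?e (pderiv h)"
      unfolding e.hom_uminus e.hom_add e.hom_mult e_s h(2) by simp
    then show ?thesis by (metis dvd_minus_iff dvd_triv_right)
  qed
  have "p \<in> range (eval2 const2 p q)" "q \<in> range (eval2 const2 p q)"
    by (metis eval2_var_x class_ring_hom_const2 rangeI)
      (metis eval2_var_y class_ring_hom_const2 rangeI)
  note pq = this[THEN dvd]
  \<comment> \<open>The terms with \<open>?e (pderiv G)\<close> cancel in this combination and leave
    the Jacobian.\<close>
  have "?e (pderiv h) dvd (partial_x p + partial_y p * ?e (pderiv G)) * partial_y q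
      - partial_y p * (partial_x q + partial_y q * ?e (pderiv G))"
    using pq by (intro dvd_diff dvd_mult dvd_mult2)
  also have "\<dots> = const2 c" unfolding J(1)[symmetric] Jac_def by (simp add: algebra_simps)
  finally have "?e (pderiv h) dvd const2 c" .
  moreover have "is_unit (const2 c)" using J(2) is_unit_cpoly2_iff by blast
  ultimately have "is_unit (?e (pderiv h))" using dvd_trans by blast
  then obtain d where d: "d \<noteq> 0" "?e (pderiv h) = ?e (?\<kappa> d)"
    unfolding e_\<kappa> is_unit_cpoly2_iff by blast
  \<comment> \<open>Equal images under \<open>?e\<close> make the difference a multiple of
    \<open>h\<close>; its degree is smaller, so it vanishes.\<close>
  then have "h dvd pderiv h - ?\<kappa> d" by (intro h(3)) (simp only: e.hom_diff diff_self)
  moreover have "degree (pderiv h - ?\<kappa> d) < degree h"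
    using h(1) by (intro degree_diff_less) (auto simp: degree_pderiv)
  ultimately have "pderiv h = ?\<kappa> d" using dvd_imp_degree_le[of h "pderiv h - ?\<kappa> d"] by fastforce
  then have "degree (pderiv h) = 0" by simp
  then have "degree h = 1" using h(1) by (simp add: degree_pderiv)
  moreover obtain a g where "h = pCons a g" by (cases h)
  ultimately have "h = pCons a g" "degree g = 0" by (auto split: if_splits)
  then obtain b where ab: "h = [:a, b:]" by (metis degree_eq_zeroE)
  with \<open>pderiv h = ?\<kappa> d\<close> have "b = const2 d" by (simp add: pderiv_pCons)
  with h(2) have 0: "eval2 const2 p q a + var_x * const2 d = 0"
    using e_const[of "const2 d"]
    by (simp add: ab eval3_pCons[of p q var_x a] eval2_const2[OF class_ring_hom_const2])
  \<comment> \<open>Solves the linear equation \<open>h\<close> for x; the quotient stays in C[p,q]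
    because \<open>d\<close> is a nonzero number.\<close>
  let ?k = "const2 (- inverse d)"
  have "eval2 const2 p q (?k * a) = ?k * eval2 const2 p q a"
    unfolding E.hom_mult eval2_const2[OF class_ring_hom_const2] ..
  also have "\<dots> = ?k * (eval2 const2 p q a + var_x * const2 d) - var_x * (?k * const2 d)"
    by (simp add: algebra_simps)
  also have "?k * const2 d = - 1" using d(1) by (simp add: const2_def one_pCons)
  finally have "eval2 const2 p q (?k * a) = var_x" using 0 by simp
  then show ?thesis by (metis rangeI)
qed

theorem theorem2p2:
  fixes F :: "cpoly2 \<Rightarrow> cpoly2" and u v :: cpoly2
  assumes "C_algebra_endomorphism F"
    and "invertible_Jacobian F"
    and "u \<in> C_subalgebra {F var_x, F var_y, var_x} - {0}"
    and "v \<in> C_subalgebra {F var_x, F var_y, var_x} - {0}"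
    and "to_fract var_y = to_fract u / to_fract v"
    and "product_of_primes_in (C_subalgebra {F var_x, F var_y, var_x}) v"
  shows "C_algebra_automorphism F"
proof -
  define p q where pq: "p = F var_x" "q = F var_y"
  define B where "B = C_subalgebra {p, q, var_x}"
  have F: "F \<in> ring_hom Cxy Cxy" "\<And>c. F (const2 c) = const2 c"
    using assms(1) by (auto simp: C_algebra_endomorphism_def)
  interpret F: class_ring_hom F
    by unfold_locales
      (use ring_hom_add[OF F(1)] ring_hom_mult[OF F(1)] ring_hom_one[OF F(1)] in simp_all)
  have F_eq: "F f = eval2 const2 p q f" for f
    using eval2_hom[OF F.class_ring_hom_axioms class_ring_hom_const2, of var_x var_y f]
    by (simp only: F(2) eval2_id pq)
  obtain c where J: "Jac p q = const2 c" "c \<noteq> 0"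
    using assms(2) by (auto simp: invertible_Jacobian_def pq)
  have "v \<noteq> 0" "u \<in> B" using assms by (auto simp: B_def pq)
  have "to_fract (v * var_y) = to_fract u" using assms(5) \<open>v \<noteq> 0\<close> by simp
  then have vy: "v * var_y \<in> B" using \<open>u \<in> B\<close> by (simp only: to_fract_eq_iff)
  obtain ps where ps: "\<And>w. w \<in> set ps \<Longrightarrow> prime_in B w" "v = prod_list ps"
    using assms(6) prime_in_if_ring_prime unfolding product_of_primes_in_def B_def pq by blast
  \<comment> \<open>Each prime is stripped by \<open>prime_in_saturated\<close>, whose cofactor may
    be any element of C[x,y].\<close>
  have "prod_list ps * a \<in> B \<Longrightarrow> a \<in> B" for a
    using ps(1)
  proof (induction ps)
    case (Cons w ps)
    have "prime_in B w" "w * (prod_list ps * a) \<in> B"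
      using Cons.prems by (simp_all add: mult.assoc)
    then have "prod_list ps * a \<in> B" by (rule prime_in_saturated[OF J B_def])
    then show ?case using Cons.IH Cons.prems(2) by simp
  qed simp
  then have "var_y \<in> B" using vy ps(2) by blast
  then obtain G where G: "var_y = eval3 p q var_x G" by (auto simp: B_def C_subalgebra_triple)
  have range: "range F = range (eval2 const2 p q)" using F_eq by auto
  have x: "var_x \<in> range F"
    unfolding range by (rule var_x_in_range_if_var_y_in_range_eval3[OF J G])
  interpret C_subalgebra_set "range F"
    by (rule C_subalgebra_set_range[OF F.class_ring_hom_axioms]) (metis F(2) rangeI)
  \<comment> \<open>\<open>range F\<close> is a subalgebra containing \<open>p\<close>,
    \<open>q\<close> and now x, hence also y = G(p,q,x).\<close>
  have y: "var_y \<in> range F"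
    unfolding G using x by (intro eval3_mem) (auto simp: pq)
  have "f \<in> range F" for f using eval2_mem[OF x y, of f] by (simp only: eval2_id)
  then have "surj F" by auto
  moreover have "inj F"
  proof (rule injI)
    fix f g assume "F f = F g"
    then have "eval2 const2 p q (f - g) = 0" by (simp only: F_eq[symmetric] F.hom_diff diff_self)
    then have "f - g = 0"
      using J by (intro eval2_inject_if_Jac_nonzero[of p q "f - g"]) (simp_all add: const2_eq_0_iff)
    then show "f = g" by simp
  qed
  ultimately show ?thesis
    using F by (simp add: C_algebra_automorphism_def ring_iso_def bij_betw_def)
qed

end
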